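(* Let $\Sigma$ be a connected signed graph with Euler-genus spectrum $\mathcal S(\Sigma)$. For $i\in\{0,1\}$ let $\mathcal S_i(\Sigma)=\{x\in\mathcal S(\Sigma): x\equiv i \pmod 2\}$ and, if $\mathcal S_i(\Sigma)\neq\varnothing$, let $\gamma^E_{i,\min}=\min\mathcal S_i(\Sigma)$ and $\gamma^E_{i,\max}=\max\mathcal S_i(\Sigma)$. For each $i\in\{0,1\}$, if $\mathcal S_i(\Sigma)$ is nonempty, then $$\mathcal S_i(\Sigma)=\{\gamma^E_{i,\min},\ \gamma^E_{i,\min}+2,\ \ldots,\ \gamma^E_{i,\max}\},$$ i.e. $\mathcal S_i(\Sigma)$ consists of all integers congruent to $i$ modulo $2$ between $\gamma^E_{i,\min}$ and $\gamma^E_{i,\max}$.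
   Context: A signed graph $\Sigma=(G,\sigma)$ is a finite graph $G$ together with a map $\sigma:E(G)\to\{+1,-1\}$; it is connected if $G$ is. A cycle of $\Sigma$ is positive if it contains an even number of edges of sign $-1$, and negative otherwise. A surface is a compact (connected) 2-dimensional manifold without boundary, orientable or not. An embedding of a graph $G$ on a surface $S$ is an embedding (homeomorphism onto its image) $\rho:G\to S$ such that every component of $S-\rho(G)$ (a face) is a 2-cell. An embedding of the signed graph $\Sigma=(G,\sigma)$ is an embedding $\rho$ of $G$ on some surface $S$ such that a cycle $C$ of $\Sigma$ is positive if and only if $\rho(C)$ is orientation-preserving on $S$. (Equivalently, in the standard combinatorial encoding, an embedding is given by a rotation system of $G$ together with the edge signature $\sigma$, faces being obtained by the usual face-tracing procedure for embedding schemes.) With $f(\rho)$ the number of faces, the Euler-genus of $\rho$ is $\gamma^E(\rho)=|E(G)|-|V(G)|+2-f(\rho)$. The Euler-genus spectrum of $\Sigma$ is $\mathcal S(\Sigma)=\{\gamma^E(\rho):\rho\text{ is an embedding of }\Sigma\}$. *)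

theory Defs
  imports
    "Graph_Theory.Graph_Theory"
    "HOL-Combinatorics.Orbits"
    "HOL-Number_Theory.Cong"
begin

text \<open>
  A finite undirected graph, with loops and parallel edges allowed, is a finite bidirected
  digraph: the arcs are the darts (half-edges), \<open>tail G a\<close> is the vertex a dart
  is attached to, and \<open>arev\<close> exchanges the two darts of an edge.  In particular a
  loop consists of two distinct darts with the same tail.
\<close>

definition edge_of :: "('b \<Rightarrow> 'b) \<Rightarrow> 'b \<Rightarrow> 'b set" where
  "edge_of arev a = {a, arev a}"

definition edge_set :: "('a, 'b) pre_digraph \<Rightarrow> ('b \<Rightarrow> 'b) \<Rightarrow> 'b set set" where
  "edge_set G arev = edge_of arev ` arcs G"

locale signed_graph = fin_digraph G + bidirected_digraph G arev
  for G :: "('a, 'b) pre_digraph" and arev :: "'b \<Rightarrow> 'b" +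
  fixes \<sigma> :: "'b set \<Rightarrow> int"
  assumes sign: "e \<in> edge_set G arev \<Longrightarrow> \<sigma> e \<in> {1, -1}"

text \<open>
  Embeddings of a signed graph are encoded by embedding schemes whose signature is the
  given one, so that an embedding is just a rotation system: a permutation of the darts
  whose restriction to the darts at each vertex is a single cycle.
\<close>

definition rotation_system :: "('a, 'b) pre_digraph \<Rightarrow> ('b \<Rightarrow> 'b) \<Rightarrow> bool" where
  "rotation_system G \<pi> \<longleftrightarrow> \<pi> permutes arcs G \<and>
     (\<forall>v \<in> verts G. out_arcs G v \<noteq> {} \<longrightarrow> cyclic_on \<pi> (out_arcs G v))"

text \<open>
  Face tracing.  A state \<open>(a, s)\<close> means that dart \<open>a\<close> is about to be
  traversed away from its tail, where the local orientation in force is the one given by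
  the rotation (\<open>s = 1\<close>) or the opposite one (\<open>s = -1\<close>).  Traversing a
  negative edge flips the orientation; the walk leaves the vertex it arrives at along the
  next dart in the orientation then in force.
\<close>

definition trace_states :: "('a, 'b) pre_digraph \<Rightarrow> ('b \<times> int) set" where
  "trace_states G = arcs G \<times> {1, -1}"

fun face_step :: "('b \<Rightarrow> 'b) \<Rightarrow> ('b set \<Rightarrow> int) \<Rightarrow> ('b \<Rightarrow> 'b) \<Rightarrow> 'b \<times> int \<Rightarrow> 'b \<times> int" where
  "face_step arev \<sigma> \<pi> (a, s) =
     (let s' = s * \<sigma> (edge_of arev a)
      in (if s' = 1 then \<pi> (arev a) else inv \<pi> (arev a), s'))"

text \<open>
  The same side of the same edge traversed in the opposite direction, which is the
  corresponding state of the reversed facial walk.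
\<close>

fun reverse_state :: "('b \<Rightarrow> 'b) \<Rightarrow> ('b set \<Rightarrow> int) \<Rightarrow> 'b \<times> int \<Rightarrow> 'b \<times> int" where
  "reverse_state arev \<sigma> (a, s) = (arev a, - (s * \<sigma> (edge_of arev a)))"

text \<open>
  A face is a closed facial walk up to choice of starting point and direction, so the orbit
  of a state is merged with the orbit of the reversed state.
\<close>

definition face_of ::
    "('b \<Rightarrow> 'b) \<Rightarrow> ('b set \<Rightarrow> int) \<Rightarrow> ('b \<Rightarrow> 'b) \<Rightarrow> 'b \<times> int \<Rightarrow> ('b \<times> int) set" where
  "face_of arev \<sigma> \<pi> x =
     orbit (face_step arev \<sigma> \<pi>) x \<union> orbit (face_step arev \<sigma> \<pi>) (reverse_state arev \<sigma> x)"

definition traced_faces ::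
    "('a, 'b) pre_digraph \<Rightarrow> ('b \<Rightarrow> 'b) \<Rightarrow> ('b set \<Rightarrow> int) \<Rightarrow> ('b \<Rightarrow> 'b) \<Rightarrow> ('b \<times> int) set set" where
  "traced_faces G arev \<sigma> \<pi> = face_of arev \<sigma> \<pi> ` trace_states G"

text \<open>
  Tracing darts does not see the face around a vertex without darts.  For a connected graph
  the second summand is nonzero only for the one-vertex graph without edges, whose embedding
  in the sphere has one face.
\<close>

definition num_faces ::
    "('a, 'b) pre_digraph \<Rightarrow> ('b \<Rightarrow> 'b) \<Rightarrow> ('b set \<Rightarrow> int) \<Rightarrow> ('b \<Rightarrow> 'b) \<Rightarrow> nat" where
  "num_faces G arev \<sigma> \<pi> =
     card (traced_faces G arev \<sigma> \<pi>) + card {v \<in> verts G. out_arcs G v = {}}"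

definition euler_genus ::
    "('a, 'b) pre_digraph \<Rightarrow> ('b \<Rightarrow> 'b) \<Rightarrow> ('b set \<Rightarrow> int) \<Rightarrow> ('b \<Rightarrow> 'b) \<Rightarrow> int" where
  "euler_genus G arev \<sigma> \<pi> =
     int (card (edge_set G arev)) - int (card (verts G)) + 2 - int (num_faces G arev \<sigma> \<pi>)"

definition euler_genus_spectrum ::
    "('a, 'b) pre_digraph \<Rightarrow> ('b \<Rightarrow> 'b) \<Rightarrow> ('b set \<Rightarrow> int) \<Rightarrow> int set" where
  "euler_genus_spectrum G arev \<sigma> = {euler_genus G arev \<sigma> \<pi> | \<pi>. rotation_system G \<pi>}"

definition parity_spectrum ::
    "('a, 'b) pre_digraph \<Rightarrow> ('b \<Rightarrow> 'b) \<Rightarrow> ('b set \<Rightarrow> int) \<Rightarrow> int \<Rightarrow> int set" where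
  "parity_spectrum G arev \<sigma> i = {x \<in> euler_genus_spectrum G arev \<sigma>. [x = i] (mod 2)}"

text \<open>
  Finiteness makes \<open>Min\<close> and \<open>Max\<close> of a nonempty parity class meaningful.
\<close>

lemma (in signed_graph) finite_parity_spectrum:
  "finite (parity_spectrum G arev \<sigma> i)"
proof -
  have "euler_genus_spectrum G arev \<sigma> \<subseteq> euler_genus G arev \<sigma> ` {\<pi>. \<pi> permutes arcs G}"
    by (auto simp: euler_genus_spectrum_def rotation_system_def)
  then have "finite (euler_genus_spectrum G arev \<sigma>)"
    using finite_permutations[OF finite_arcs] by (meson finite_imageI finite_subset)
  then show ?thesis by (simp add: parity_spectrum_def)
qed

end

theory Submission
  imports Defs
begin

text \<open>
  The genus depends on a rotation system only through its number of faces, so it suffices to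
  realise every face count \<open>k\<close> that lies between those of two rotation systems \<open>\<pi>\<close> and \<open>\<psi>\<close>,
  with \<open>\<pi>\<close> the one with fewer faces, and has the parity of that of \<open>\<psi>\<close>.  Composing a
  permutation of the darts with a transposition changes the number of faces by at most one,
  even when the result is not a rotation system, and two suitable transpositions lead from
  \<open>\<pi>\<close> to a rotation system closer to \<open>\<psi>\<close>.  So the only danger is to jump from \<open>k - 1\<close> to
  \<open>k + 1\<close>.  A transposition can increase the number of faces only if its two corners lie on one
  face and are traversed in the same direction.  If this were so for all corners in a common
  cycle of \<open>inv \<psi> \<circ> \<pi>\<close>, then passing from \<open>\<pi>\<close> to \<open>\<psi>\<close> would respect an orientation of the
  faces of \<open>\<pi>\<close>, and, as in an oriented surface, the number of faces of \<open>\<psi>\<close> would have the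
  same parity as that of \<open>\<pi>\<close>, which is \<open>k - 1\<close>.  Hence some first transposition does not
  increase the number of faces, and the second one cannot take it beyond \<open>k\<close>.
\<close>

section \<open>Orbits of a permutation composed with a transposition\<close>

definition orbits :: "('a \<Rightarrow> 'a) \<Rightarrow> 'a set \<Rightarrow> 'a set set" where
  "orbits g A = orbit g ` A"

lemma finite_orbits: "finite A \<Longrightarrow> finite (orbits g A)"
  by (simp add: orbits_def)

lemma self_in_orbit_permutes:
  assumes "g permutes A" "finite A"
  shows "x \<in> orbit g x"
  using assms by (meson permutation_permutes permutation_self_in_orbit)

lemma orbit_eq_permutes:
  assumes "g permutes A" "finite A" "y \<in> orbit g x"
  shows "orbit g y = orbit g x"
  using assms by (meson cyclic_on_orbit orbit_cyclic_eq3)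

lemma permutes_eqI:
  assumes "\<pi> permutes A" "\<psi> permutes A" "\<And>a. a \<in> A \<Longrightarrow> inv \<psi> (\<pi> a) = a"
  shows "\<pi> = \<psi>"
proof
  fix a
  show "\<pi> a = \<psi> a"
  proof (cases "a \<in> A")
    case True
    then show ?thesis using assms(3)[OF True] permutes_inverses(1)[OF assms(2), of "\<pi> a"] by simp
  next
    case False
    then show ?thesis using assms(1,2) by (simp add: permutes_not_in)
  qed
qed

lemma orbit_subset_closed:
  assumes "x \<in> S" "\<And>y. y \<in> S \<Longrightarrow> g y \<in> S"
  shows "orbit g x \<subseteq> S"
proof
  fix y assume "y \<in> orbit g x"
  then show "y \<in> S" by induct (use assms in auto)
qed

lemma permutes_comp_transpose:
  assumes "g permutes A" "p \<in> A" "q \<in> A"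
  shows "g \<circ> transpose p q permutes A"
  using assms by (meson permutes_compose permutes_swap_id)

lemma comp_transpose_transpose [simp]: "g \<circ> transpose p q \<circ> transpose p q = g"
  by (simp add: comp_assoc)

text \<open>
  The \<open>g\<close>-path from \<open>g q\<close> up to its first visit of \<open>{p, q}\<close> is also a path of
  \<open>g \<circ> transpose p q\<close>.
\<close>

lemma first_visit:
  assumes "g permutes A" "finite A"
  obtains S r where "r \<in> {p, q}" "r \<in> S" "g q \<in> S" "S \<inter> {p, q} = {r}"
    "S \<subseteq> orbit g q" "S \<subseteq> orbit (g \<circ> transpose p q) p"
    "\<And>y. y \<in> S \<Longrightarrow> y \<noteq> r \<Longrightarrow> g y \<in> S"
proof -
  define P where "P n \<longleftrightarrow> (g ^^ n) (g q) \<in> {p, q}" for n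
  obtain m where "0 < m" "(g ^^ m) q = q"
    using self_in_orbit_permutes[OF assms, of q] unfolding orbit_altdef by auto
  then have "P (m - 1)"
    unfolding P_def by (cases m) (auto simp: funpow_swap1)
  define n where "n = (LEAST n. P n)"
  have n: "P n" unfolding n_def by (rule LeastI, fact)
  have less: "\<not> P i" if "i < n" for i using that not_less_Least unfolding n_def by blast
  define S where "S = (\<lambda>i. (g ^^ i) (g q)) ` {..n}"
  define r where "r = (g ^^ n) (g q)"
  show ?thesis
  proof
    show "r \<in> {p, q}" using n unfolding P_def r_def .
    show rS: "r \<in> S" by (auto simp: r_def S_def)
    show "g q \<in> S" unfolding S_def by (rule image_eqI[of _ _ 0]) auto
    show "S \<inter> {p, q} = {r}"
    proof -
      have "x = r" if xS: "x \<in> S" "x \<in> {p, q}" for x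
      proof -
        obtain i where "i \<le> n" "x = (g ^^ i) (g q)" using xS S_def by auto
        then show "x = r" using xS less[of i] unfolding P_def r_def by (cases "i = n") auto
      qed
      then show ?thesis using rS \<open>r \<in> {p, q}\<close> by blast
    qed
    show "S \<subseteq> orbit g q"
      unfolding S_def by (auto intro: funpow_in_orbit orbit.base)
    show "S \<subseteq> orbit (g \<circ> transpose p q) p"
    proof -
      have "(g ^^ i) (g q) \<in> orbit (g \<circ> transpose p q) p" if "i \<le> n" for i
        using that
      proof (induction i)
        case 0
        have "(g \<circ> transpose p q) p = g q" by simp
        then show ?case using orbit.base[of "g \<circ> transpose p q" p] by (metis funpow_0)
      next
        case (Suc i)
        then have "(g ^^ i) (g q) \<notin> {p, q}" using less[of i] unfolding P_def by auto
        then have "(g \<circ> transpose p q) ((g ^^ i) (g q)) = (g ^^ Suc i) (g q)" by simp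
        then show ?case using Suc by (metis Suc_leD orbit.step)
      qed
      then show ?thesis by (auto simp: S_def)
    qed
    show "g y \<in> S" if y: "y \<in> S" "y \<noteq> r" for y
    proof -
      obtain i where i: "i \<le> n" "y = (g ^^ i) (g q)" using y S_def by auto
      then have "i < n" using y r_def by (cases "i = n") auto
      then show ?thesis unfolding S_def using i by (intro image_eqI[of _ _ "Suc i"]) auto
    qed
  qed
qed

text \<open>On the cycle through \<open>p\<close> and \<open>q\<close>, the path from
  \<open>g q\<close> meets \<open>p\<close> before it returns to \<open>q\<close>. Since the new
  permutation sends \<open>p\<close> to \<open>g q\<close>, this arc closes up into a cycle that
  avoids \<open>q\<close>.\<close>

lemma orbit_transpose_split:
  assumes g: "g permutes A" "finite A" and pq: "p \<noteq> q" "q \<in> orbit g p"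
  shows "q \<notin> orbit (g \<circ> transpose p q) p"
proof -
  obtain S r where S: "r \<in> {p, q}" "r \<in> S" "S \<inter> {p, q} = {r}" "g q \<in> S"
    "\<And>y. y \<in> S \<Longrightarrow> y \<noteq> r \<Longrightarrow> g y \<in> S" using first_visit[OF g, of p q] by metis
  \<comment> \<open>If the path came back to \<open>q\<close> first, it would already be the whole
    cycle of \<open>q\<close> and would miss \<open>p\<close>.\<close>
  have "r \<noteq> q"
  proof
    assume r: "r = q"
    have "orbit g q \<subseteq> S"
      by (rule orbit_subset_closed) (use S r in auto)
    moreover have "p \<in> orbit g q"
      using orbit_eq_permutes[OF g pq(2)] self_in_orbit_permutes[OF g] by metis
    ultimately show False using S r pq by auto
  qed
  then have r: "r = p" using S by auto
  have "orbit (g \<circ> transpose p q) p \<subseteq> S"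
  proof (rule orbit_subset_closed)
    show "(g \<circ> transpose p q) y \<in> S" if "y \<in> S" for y
    proof (cases "y = p")
      case False
      then have "y \<noteq> q" using S(3) r that pq by auto
      then show ?thesis using False S(5) r that by simp
    qed (use S in simp)
  qed (use S r in simp)
  then show ?thesis using S r pq by auto
qed

text \<open>The new permutation leaves \<open>p\<close> for \<open>g q\<close>, runs through the
  whole old cycle of \<open>q\<close> as far as \<open>q\<close>, and from there enters the old
  cycle of \<open>p\<close> at \<open>g p\<close>.\<close>

lemma orbit_transpose_merge:
  assumes g: "g permutes A" "finite A" and A: "p \<in> A" "q \<in> A" and pq: "q \<notin> orbit g p"
  shows "orbit (g \<circ> transpose p q) p = orbit g p \<union> orbit g q"
proof -
  let ?h = "g \<circ> transpose p q"
  note h = permutes_comp_transpose[OF g(1) A]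
  \<comment> \<open>Stated for arbitrary \<open>a\<close> and \<open>b\<close> because it is used
    twice, with the roles of \<open>p\<close> and \<open>q\<close> exchanged.\<close>
  have into: "orbit g b \<subseteq> orbit (g \<circ> transpose a b) a \<and> b \<in> orbit (g \<circ> transpose a b) a"
    if ab: "a \<notin> orbit g b" for a b
  proof -
    obtain S r where S: "r \<in> {a, b}" "r \<in> S" "g b \<in> S" "S \<subseteq> orbit g b"
      "S \<subseteq> orbit (g \<circ> transpose a b) a"
      "\<And>y. y \<in> S \<Longrightarrow> y \<noteq> r \<Longrightarrow> g y \<in> S" using first_visit[OF g, of a b] by metis
    have r: "r = b" using S ab by auto
    have "orbit g b \<subseteq> S"
      by (rule orbit_subset_closed) (use S r in auto)
    then show ?thesis using S r by auto
  qed
  have qp: "p \<notin> orbit g q"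
    using pq orbit_eq_permutes[OF g] self_in_orbit_permutes[OF g] by metis
  have 1: "orbit g q \<subseteq> orbit ?h p" "q \<in> orbit ?h p" using into[OF qp] by auto
  have "orbit g p \<subseteq> orbit ?h q" using into[OF pq] by (simp add: transpose_commute)
  also have "\<dots> = orbit ?h p" using orbit_eq_permutes[OF h g(2) 1(2)] .
  finally have 2: "orbit g p \<subseteq> orbit ?h p" .
  have "orbit ?h p \<subseteq> orbit g p \<union> orbit g q"
  proof (rule orbit_subset_closed)
    show "p \<in> orbit g p \<union> orbit g q" using self_in_orbit_permutes[OF g] by auto
    show "?h y \<in> orbit g p \<union> orbit g q" if "y \<in> orbit g p \<union> orbit g q" for y
      using that by (cases "y = p"; cases "y = q") (auto intro: orbit.intros)
  qed
  with 1 2 show ?thesis by blast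
qed

lemma orbits_transpose_merge:
  assumes g: "g permutes A" "finite A" and A: "p \<in> A" "q \<in> A" and pq: "q \<notin> orbit g p"
  shows "orbits (g \<circ> transpose p q) A
    = insert (orbit g p \<union> orbit g q) (orbits g A - {orbit g p, orbit g q})"
proof -
  let ?h = "g \<circ> transpose p q" and ?U = "orbit g p \<union> orbit g q"
  note h = permutes_comp_transpose[OF g(1) A]
  have U: "orbit ?h x = ?U" if "x \<in> ?U" for x
    using orbit_transpose_merge[OF g A pq] orbit_eq_permutes[OF h g(2)] that by metis
  have nU: "orbit ?h x = orbit g x" if "x \<notin> ?U" for x
  proof (rule orbit_cong)
    show "x \<in> orbit g x" using self_in_orbit_permutes[OF g] .
    fix s assume "s \<in> orbit g x"
    then have "orbit g s = orbit g x" using orbit_eq_permutes[OF g] by simp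
    then have "s \<noteq> p" "s \<noteq> q" using that self_in_orbit_permutes[OF g] by auto
    then show "?h s = g s" by simp
  qed
  have iff: "x \<in> ?U \<longleftrightarrow> orbit g x = orbit g p \<or> orbit g x = orbit g q" for x
    using orbit_eq_permutes[OF g] self_in_orbit_permutes[OF g] by blast
  show ?thesis
  proof (intro equalityI subsetI)
    fix X assume "X \<in> orbits ?h A"
    then obtain x where "x \<in> A" "X = orbit ?h x" by (auto simp: orbits_def)
    then show "X \<in> insert ?U (orbits g A - {orbit g p, orbit g q})"
      using U nU iff[of x] by (cases "x \<in> ?U") (auto simp: orbits_def)
  next
    fix X assume X: "X \<in> insert ?U (orbits g A - {orbit g p, orbit g q})"
    show "X \<in> orbits ?h A"
    proof (cases "X = ?U")
      case True
      then show ?thesis using U[of p] self_in_orbit_permutes[OF g, of p] A by (auto simp: orbits_def)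
    next
      case False
      then obtain x where "x \<in> A" "X = orbit g x" "x \<notin> ?U" using X iff by (auto simp: orbits_def)
      then show ?thesis using nU by (auto simp: orbits_def)
    qed
  qed
qed

lemma card_orbits_merge:
  assumes g: "g permutes A" "finite A" and A: "p \<in> A" "q \<in> A" and pq: "q \<notin> orbit g p"
  shows "card (orbits g A) = Suc (card (orbits (g \<circ> transpose p q) A))"
proof -
  have "orbit g p \<noteq> orbit g q" using pq self_in_orbit_permutes[OF g] by metis
  moreover have "{orbit g p, orbit g q} \<subseteq> orbits g A" using A by (auto simp: orbits_def)
  moreover have "orbit g p \<union> orbit g q \<notin> orbits g A - {orbit g p, orbit g q}"
  proof
    assume "orbit g p \<union> orbit g q \<in> orbits g A - {orbit g p, orbit g q}"
    then obtain x where x: "orbit g x = orbit g p \<union> orbit g q" by (auto simp: orbits_def)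
    then have "p \<in> orbit g x" "q \<in> orbit g x" using self_in_orbit_permutes[OF g] by auto
    then show False using \<open>orbit g p \<noteq> orbit g q\<close> orbit_eq_permutes[OF g] by metis
  qed
  moreover have "card {orbit g p, orbit g q} \<le> card (orbits g A)"
    using calculation finite_orbits[OF g(2)] by (intro card_mono) auto
  ultimately show ?thesis
    unfolding orbits_transpose_merge[OF assms]
    using finite_orbits[OF g(2), of g] by (simp add: card_Diff_subset card_insert_if)
qed

text \<open>The inverse of a merge: composing once more with the same transposition restores
  \<open>g\<close>.\<close>

lemma card_orbits_split:
  assumes g: "g permutes A" "finite A" and A: "p \<in> A" "q \<in> A"
    and pq: "p \<noteq> q" "q \<in> orbit g p"
  shows "card (orbits (g \<circ> transpose p q) A) = Suc (card (orbits g A))"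
  using card_orbits_merge[OF permutes_comp_transpose[OF g(1) A] g(2) A orbit_transpose_split[OF g pq]]
  by simp

lemma card_orbits_transpose:
  assumes g: "g permutes A" "finite A" and A: "p \<in> A" "q \<in> A" and pq: "p \<noteq> q"
  shows "card (orbits (g \<circ> transpose p q) A) = Suc (card (orbits g A)) \<or>
    card (orbits g A) = Suc (card (orbits (g \<circ> transpose p q) A))"
  using card_orbits_merge[OF g A] card_orbits_split[OF g A pq] by auto

lemma card_orbits_le: "finite A \<Longrightarrow> card (orbits g A) \<le> card A"
  by (simp add: orbits_def card_image_le)

text \<open>\<open>permutes H\<close> demands the identity outside \<open>H\<close>. Restricting a
  permutation to an invariant set achieves this without changing the cycles inside, so that the
  counting lemmas above apply to \<open>H\<close>.\<close>

lemma orbits_perm_restrict: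
  assumes "\<And>x. x \<in> H \<Longrightarrow> g x \<in> H"
  shows "orbits (perm_restrict g H) H = orbits g H"
proof -
  have "orbit (perm_restrict g H) x = orbit g x" if "x \<in> H" for x
    using that assms by (intro orbit_cong0[of x H]) (auto simp: perm_restrict_def)
  then show ?thesis by (auto simp: orbits_def)
qed

lemma perm_restrict_permutes:
  assumes "g permutes A" "finite A" "H \<subseteq> A" "\<And>x. x \<in> H \<Longrightarrow> g x \<in> H"
  shows "perm_restrict g H permutes H"
proof (rule bij_imp_permutes)
  have "inj_on g H" using assms by (meson permutes_inj_on)
  moreover have "g ` H = H"
    using assms calculation finite_subset by (intro endo_inj_surj) auto
  ultimately have "bij_betw g H H" by (simp add: bij_betw_def)
  then show "bij_betw (perm_restrict g H) H H"
    by (rule bij_betw_cong[THEN iffD1, rotated]) (simp add: perm_restrict_def)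
qed (simp add: perm_restrict_def)

section \<open>Face tracing as a permutation\<close>

context signed_graph
begin

abbreviation states :: "('b \<times> int) set" where "states \<equiv> trace_states G"

text \<open>
  A face step crosses an edge and then turns at the vertex reached.  Both maps are the identity
  outside the tracing states, which makes them permutations.
\<close>

definition cross :: "'b \<times> int \<Rightarrow> 'b \<times> int" where
  "cross x = (if x \<in> states then (arev (fst x), snd x * \<sigma> (edge_of arev (fst x))) else x)"

definition turn :: "('b \<Rightarrow> 'b) \<Rightarrow> 'b \<times> int \<Rightarrow> 'b \<times> int" where
  "turn \<pi> x = (if x \<in> states then (if snd x = 1 then \<pi> (fst x) else inv \<pi> (fst x), snd x) else x)"

definition face_perm :: "('b \<Rightarrow> 'b) \<Rightarrow> 'b \<times> int \<Rightarrow> 'b \<times> int" where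
  "face_perm \<pi> = turn \<pi> \<circ> cross"

definition opp :: "'b \<times> int \<Rightarrow> 'b \<times> int" where
  "opp x = (fst x, - snd x)"

text \<open>On tracing states this is \<open>reverse_state\<close>. \<open>opp\<close> passes to the
  other side of the edge while keeping the direction of traversal.\<close>

abbreviation mirror :: "'b \<times> int \<Rightarrow> 'b \<times> int" where
  "mirror x \<equiv> cross (opp x)"

abbreviation faces :: "('b \<Rightarrow> 'b) \<Rightarrow> ('b \<times> int) set set" where
  "faces \<equiv> traced_faces G arev \<sigma>"

lemma in_states: "(a, s) \<in> states \<longleftrightarrow> a \<in> arcs G \<and> (s = 1 \<or> s = -1)"
  by (auto simp: trace_states_def)

lemma finite_states [simp]: "finite states"
  by (simp add: trace_states_def)

lemma arev_in: "a \<in> arcs G \<Longrightarrow> arev a \<in> arcs G"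
  using arev_dom arev_arev_raw by metis

lemma edge_of_arev: "a \<in> arcs G \<Longrightarrow> edge_of arev (arev a) = edge_of arev a"
  by (auto simp: edge_of_def arev_arev_raw)

lemma sign_cases: "a \<in> arcs G \<Longrightarrow> \<sigma> (edge_of arev a) = 1 \<or> \<sigma> (edge_of arev a) = -1"
  using sign[of "edge_of arev a"] by (auto simp: edge_set_def)

lemma cross_in [simp]: "x \<in> states \<Longrightarrow> cross x \<in> states"
  using sign_cases[of "fst x"] by (cases x) (auto simp: cross_def in_states arev_in)

lemma cross_cross [simp]: "cross (cross x) = x"
proof (cases "x \<in> states")
  case True
  then show ?thesis using sign_cases[of "fst x"] cross_in[OF True]
    by (cases x) (auto simp: cross_def in_states edge_of_arev arev_arev_raw)
qed (simp add: cross_def)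

lemma cross_permutes: "cross permutes states"
proof (rule bij_imp_permutes)
  show "bij_betw cross states states"
    by (rule bij_betw_byWitness[where f' = cross]) auto
qed (simp add: cross_def)

lemma turn_in:
  assumes "\<pi> permutes arcs G" "x \<in> states"
  shows "turn \<pi> x \<in> states"
  using assms permutes_inv[OF assms(1)]
  by (cases x) (auto simp: turn_def in_states permutes_in_image)

lemma opp_in [simp]: "x \<in> states \<Longrightarrow> opp x \<in> states"
  by (cases x) (auto simp: opp_def in_states)

lemma opp_opp [simp]: "opp (opp x) = x"
  by (simp add: opp_def)

text \<open>Reversing the local orientation replaces \<open>\<pi>\<close> by its inverse, so the
  second turn undoes the first.\<close>

lemma turn_opp_turn:
  assumes "\<pi> permutes arcs G" "x \<in> states"
  shows "turn \<pi> (opp (turn \<pi> x)) = opp x"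
  using assms turn_in[OF assms] opp_in[OF turn_in[OF assms]] permutes_inverses[OF assms(1)]
  by (cases x) (auto simp: turn_def opp_def in_states)

lemma turn_permutes:
  assumes "\<pi> permutes arcs G"
  shows "turn \<pi> permutes states"
proof (rule bij_imp_permutes)
  have "turn \<pi> ` states \<subseteq> states" "(opp \<circ> turn \<pi> \<circ> opp) ` states \<subseteq> states"
    using turn_in[OF assms] opp_in unfolding image_subset_iff comp_apply by blast+
  then show "bij_betw (turn \<pi>) states states"
    by (intro bij_betw_byWitness[where f' = "opp \<circ> turn \<pi> \<circ> opp"])
      (simp_all add: turn_opp_turn[OF assms])
qed (simp add: turn_def)

lemma face_perm_permutes: "\<pi> permutes arcs G \<Longrightarrow> face_perm \<pi> permutes states"
  unfolding face_perm_def using cross_permutes turn_permutes by (rule permutes_compose)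

lemma face_perm_in: "\<pi> permutes arcs G \<Longrightarrow> x \<in> states \<Longrightarrow> face_perm \<pi> x \<in> states"
  using face_perm_permutes permutes_in_image by metis

section \<open>Reversal symmetry of face tracing\<close>

lemma opp_cross: "x \<in> states \<Longrightarrow> opp (cross x) = mirror x"
  using opp_in[of x] by (cases x) (auto simp: cross_def opp_def)

lemma mirror_mirror: "x \<in> states \<Longrightarrow> mirror (mirror x) = x"
  by (metis cross_cross opp_cross opp_in opp_opp)

lemma mirror_neq: "x \<in> states \<Longrightarrow> mirror x \<noteq> x"
  using arev_dom opp_in[of x] by (cases x) (auto simp: cross_def opp_def in_states)

text \<open>In other words, conjugation by \<open>mirror\<close> inverts
  \<open>face_perm \<pi>\<close>: facial walks are reversed.\<close>

lemma face_perm_mirror: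
  assumes "\<pi> permutes arcs G" "x \<in> states"
  shows "face_perm \<pi> (mirror (face_perm \<pi> x)) = mirror x"
  using assms turn_opp_turn[OF assms(1) cross_in] by (simp add: face_perm_def opp_cross)

text \<open>No facial walk coincides with its own reversal. Otherwise, shortening the stretch
  between \<open>x\<close> and \<open>mirror x\<close> from both ends would lead to a state equal to
  its mirror image or followed immediately by it.\<close>

lemma mirror_notin_orbit:
  assumes \<pi>: "\<pi> permutes arcs G" and x: "x \<in> states"
  shows "mirror x \<notin> orbit (face_perm \<pi>) x"
proof -
  have "(face_perm \<pi> ^^ n) x \<noteq> mirror x" for n using x
  proof (induction n arbitrary: x rule: induct_nat_012)
    case 0
    then show ?case using mirror_neq by (metis funpow_0)
  next
    case 1
    \<comment> \<open>A turn keeps the orientation of \<open>cross x\<close>, whereas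
      \<open>mirror x = opp (cross x)\<close> has the opposite one.\<close>
    have "snd (face_perm \<pi> x) \<noteq> snd (mirror x)"
      using cross_in[OF 1] opp_cross[OF 1, symmetric]
      by (cases "cross x") (auto simp: face_perm_def turn_def opp_def in_states)
    then show ?case by auto
  next
    case (ge2 n)
    show ?case
    proof
      assume "(face_perm \<pi> ^^ Suc (Suc n)) x = mirror x"
      then have "face_perm \<pi> ((face_perm \<pi> ^^ n) (face_perm \<pi> x))
          = face_perm \<pi> (mirror (face_perm \<pi> x))"
        using face_perm_mirror[OF \<pi> ge2.prems] by (simp add: funpow_swap1)
      then have "(face_perm \<pi> ^^ n) (face_perm \<pi> x) = mirror (face_perm \<pi> x)"
        using permutes_inj[OF face_perm_permutes[OF \<pi>]] by (simp add: inj_eq)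
      then show False using ge2 face_perm_in[OF \<pi>] by blast
    qed
  qed
  then show ?thesis by (simp add: orbit_altdef) metis
qed

lemma orbit_in_states:
  "\<pi> permutes arcs G \<Longrightarrow> x \<in> states \<Longrightarrow> orbit (face_perm \<pi>) x \<subseteq> states"
  using face_perm_permutes permutes_orbit_subset by metis

lemma orbit_mirror:
  assumes \<pi>: "\<pi> permutes arcs G" and x: "x \<in> states"
  shows "orbit (face_perm \<pi>) (mirror x) = mirror ` orbit (face_perm \<pi>) x"
proof -
  note perm = face_perm_permutes[OF \<pi>] finite_states
  have sub: "mirror ` orbit (face_perm \<pi>) x \<subseteq> orbit (face_perm \<pi>) (mirror x)" if x: "x \<in> states" for x
  proof -
    have step: "orbit (face_perm \<pi>) (mirror (face_perm \<pi> y)) = orbit (face_perm \<pi>) (mirror y)"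
      if "y \<in> states" for y
      using face_perm_mirror[OF \<pi> that] orbit.base orbit_eq_permutes[OF perm] by metis
    have "y \<in> states \<and> orbit (face_perm \<pi>) (mirror y) = orbit (face_perm \<pi>) (mirror x)"
      if "y \<in> orbit (face_perm \<pi>) x" for y
      using that by induct (use step x face_perm_in[OF \<pi>] in auto)
    then show ?thesis using self_in_orbit_permutes[OF perm] by (metis image_subsetI)
  qed
  have "mirror ` orbit (face_perm \<pi>) (mirror x) \<subseteq> orbit (face_perm \<pi>) x"
    using sub[of "mirror x"] mirror_mirror[OF x] x by simp
  then have "mirror ` mirror ` orbit (face_perm \<pi>) (mirror x) \<subseteq> mirror ` orbit (face_perm \<pi>) x"
    by blast
  moreover have "mirror ` mirror ` orbit (face_perm \<pi>) (mirror x) = orbit (face_perm \<pi>) (mirror x)"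
  proof -
    have "mirror (mirror y) = y" if "y \<in> orbit (face_perm \<pi>) (mirror x)" for y
      using that orbit_in_states[OF \<pi>, of "mirror x"] x by (intro mirror_mirror) auto
    then show ?thesis by (simp add: image_image)
  qed
  ultimately show ?thesis using sub[OF x] by blast
qed

text \<open>On tracing states, \<open>face_perm\<close> agrees with \<open>face_step\<close> and
  \<open>mirror\<close> with \<open>reverse_state\<close>.\<close>

lemma face_of_eq:
  assumes "\<pi> permutes arcs G" "x \<in> states"
  shows "face_of arev \<sigma> \<pi> x = orbit (face_perm \<pi>) x \<union> orbit (face_perm \<pi>) (mirror x)"
proof -
  have eq: "face_step arev \<sigma> \<pi> y = face_perm \<pi> y" if "y \<in> states" for y
    using that cross_in[OF that]
    by (cases y) (auto simp: face_perm_def turn_def cross_def Let_def)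
  have "orbit (face_step arev \<sigma> \<pi>) y = orbit (face_perm \<pi>) y" if "y \<in> states" for y
    by (rule orbit_cong0[OF that]) (use eq face_perm_in[OF assms(1)] in auto)
  moreover have "reverse_state arev \<sigma> x = mirror x"
    using assms(2) opp_cross[OF assms(2), symmetric] by (cases x) (auto simp: cross_def opp_def)
  ultimately show ?thesis using assms by (simp add: face_of_def)
qed

text \<open>Each corner is passed in both directions. With orientation 1 the turn uses
  \<open>\<pi>\<close>, so \<open>a\<close> and \<open>b\<close> are swapped before it. With
  orientation -1 it uses the inverse, and \<open>transpose a b \<circ> inv \<pi>\<close> equals
  \<open>inv \<pi> \<circ> transpose (\<pi> a) (\<pi> b)\<close>. Moving both swaps past
  \<open>cross\<close> gives the formula.\<close>

lemma face_perm_transpose: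
  assumes \<pi>: "\<pi> permutes arcs G" and a: "a \<in> arcs G" and b: "b \<in> arcs G"
  shows "face_perm (\<pi> \<circ> transpose a b) = face_perm \<pi>
    \<circ> transpose (cross (a, 1)) (cross (b, 1))
    \<circ> transpose (cross (\<pi> a, -1)) (cross (\<pi> b, -1))"
proof
  fix x
  have inv: "inv (\<pi> \<circ> transpose a b) c = transpose a b (inv \<pi> c)" for c
    using \<pi> by (simp add: o_inv_distrib permutes_bij)
  have im: "\<pi> a \<in> arcs G" "\<pi> b \<in> arcs G" using assms by (simp_all add: permutes_in_image)
  have turn: "turn (\<pi> \<circ> transpose a b) y
      = turn \<pi> (transpose (a, 1) (b, 1) (transpose (\<pi> a, -1) (\<pi> b, -1) y))" for y
  proof (cases "y \<in> states")
    case True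
    then obtain c s where y: "y = (c, s)" "c \<in> arcs G" "s = 1 \<or> s = -1"
      by (cases y) (auto simp: in_states)
    have eq: "inv \<pi> c = d \<longleftrightarrow> c = \<pi> d" for d
      using permutes_inverses[OF \<pi>] by metis
    show ?thesis
      using y a b im permutes_inverses[OF \<pi>]
      by (auto simp: turn_def in_states inv transpose_def eq)
  next
    case False
    then show ?thesis using a b im by (auto simp: turn_def in_states transpose_def)
  qed
  have eq: "cross y = z \<longleftrightarrow> y = cross z" for y z by auto
  have conj: "transpose y z (cross x) = cross (transpose (cross y) (cross z) x)" for x y z
    by (auto simp: transpose_def eq)
  show "face_perm (\<pi> \<circ> transpose a b) x = (face_perm \<pi>
    \<circ> transpose (cross (a, 1)) (cross (b, 1))
    \<circ> transpose (cross (\<pi> a, -1)) (cross (\<pi> b, -1))) x"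
    by (simp add: face_perm_def turn conj)
qed

section \<open>Orientations of the faces\<close>

text \<open>
  A half contains one of the two directed facial walks along each side of each edge; choosing
  a half that is closed under face tracing amounts to orienting every face.
\<close>

definition half :: "('b \<times> int) set \<Rightarrow> bool" where
  "half H \<longleftrightarrow> H \<subseteq> states \<and> (\<forall>x\<in>states. mirror x \<in> H \<longleftrightarrow> x \<notin> H)"

definition orients :: "('b \<times> int) set \<Rightarrow> ('b \<Rightarrow> 'b) \<Rightarrow> bool" where
  "orients H \<pi> \<longleftrightarrow> half H \<and> (\<forall>x\<in>states. face_perm \<pi> x \<in> H \<longleftrightarrow> x \<in> H)"

lemma orients_orbit:
  assumes "orients H \<pi>" "\<pi> permutes arcs G" "x \<in> states" "y \<in> orbit (face_perm \<pi>) x"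
  shows "y \<in> H \<longleftrightarrow> x \<in> H"
proof -
  have "y \<in> states \<and> (y \<in> H \<longleftrightarrow> x \<in> H)"
    using assms(4) by induct (use assms face_perm_in[OF assms(2)] in \<open>auto simp: orients_def\<close>)
  then show ?thesis ..
qed

lemma exists_orientation:
  assumes \<pi>: "\<pi> permutes arcs G"
  shows "\<exists>H. orients H \<pi>"
proof -
  note perm = face_perm_permutes[OF \<pi>] finite_states
  let ?O = "orbit (face_perm \<pi>)"
  define F where "F x = ?O x \<union> ?O (mirror x)" for x
  \<comment> \<open>The chosen state depends on \<open>x\<close> only through \<open>F x\<close>, so
    all states of a face share one representative \<open>r x\<close>, whose orbit provides the
    orientation of that face.\<close>
  define r where "r x = (SOME y. y \<in> states \<and> F y = F x)" for x
  define H where "H = {x \<in> states. x \<in> ?O (r x)}"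
  have r: "r x \<in> states" "F (r x) = F x" if "x \<in> states" for x
    using someI[of "\<lambda>y. y \<in> states \<and> F y = F x" x] that unfolding r_def by auto
  have Fm: "F (mirror x) = F x" if "x \<in> states" for x
    using mirror_mirror[OF that] by (auto simp: F_def)
  have Ff: "F (face_perm \<pi> x) = F x" if "x \<in> states" for x
  proof -
    have "?O (face_perm \<pi> x) = ?O x"
      using orbit.base orbit_eq_permutes[OF perm] by metis
    moreover have "?O (mirror (face_perm \<pi> x)) = ?O (mirror x)"
      using face_perm_mirror[OF \<pi> that] orbit.base orbit_eq_permutes[OF perm] by metis
    ultimately show ?thesis by (simp add: F_def)
  qed
  have rcong: "r x = r y" if "F x = F y" for x y using that by (simp add: r_def)
  have "mirror x \<in> H \<longleftrightarrow> x \<notin> H" if x: "x \<in> states" for x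
  proof -
    let ?r = "r x"
    have "x \<in> F ?r" using r[OF x] self_in_orbit_permutes[OF perm] by (auto simp: F_def)
    then have "x \<in> ?O ?r \<or> x \<in> mirror ` ?O ?r"
      using orbit_mirror[OF \<pi> r(1)[OF x]] by (auto simp: F_def)
    moreover have "mirror x \<in> ?O ?r" if "x \<in> mirror ` ?O ?r"
      using that orbit_in_states[OF \<pi> r(1)[OF x]] mirror_mirror by force
    moreover have "mirror x \<notin> ?O ?r" if "x \<in> ?O ?r"
      using mirror_notin_orbit[OF \<pi> x] orbit_eq_permutes[OF perm that] by simp
    moreover have "r (mirror x) = ?r" using Fm[OF x] by (rule rcong)
    ultimately show ?thesis using x unfolding H_def by auto
  qed
  moreover have "face_perm \<pi> x \<in> H \<longleftrightarrow> x \<in> H" if x: "x \<in> states" for x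
  proof -
    have "r (face_perm \<pi> x) = r x" using Ff[OF x] by (rule rcong)
    moreover have "face_perm \<pi> x \<in> ?O (r x) \<longleftrightarrow> x \<in> ?O (r x)"
    proof -
      have "?O (face_perm \<pi> x) = ?O x" using orbit.base orbit_eq_permutes[OF perm] by metis
      then show ?thesis using self_in_orbit_permutes[OF perm] orbit_eq_permutes[OF perm] by metis
    qed
    ultimately show ?thesis using x face_perm_in[OF \<pi> x] by (simp add: H_def)
  qed
  ultimately have "orients H \<pi>" by (auto simp: orients_def half_def H_def)
  then show ?thesis ..
qed

text \<open>Each face is the union of two mutually mirrored orbits, and \<open>H\<close> contains
  exactly one of them.\<close>

lemma card_faces_orients:
  assumes H: "orients H \<pi>" and \<pi>: "\<pi> permutes arcs G"
  shows "card (faces \<pi>) = card (orbits (face_perm \<pi>) H)"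
proof -
  note perm = face_perm_permutes[OF \<pi>] finite_states
  have HS: "H \<subseteq> states" using H by (auto simp: orients_def half_def)
  define F where "F X = X \<union> mirror ` X" for X
  have F: "F (orbit (face_perm \<pi>) x) = face_of arev \<sigma> \<pi> x" if "x \<in> states" for x
    using that by (simp add: F_def orbit_mirror[OF \<pi>] face_of_eq[OF \<pi>])
  \<comment> \<open>The orbit can be recovered from its face, because its mirror image lies outside
    \<open>H\<close>.\<close>
  have "F X \<inter> H = X" if X: "X \<in> orbits (face_perm \<pi>) H" for X
  proof -
    obtain x where x: "x \<in> H" "X = orbit (face_perm \<pi>) x" using X by (auto simp: orbits_def)
    have "X \<subseteq> H" using orients_orbit[OF H \<pi>] x HS by blast
    moreover have "mirror y \<notin> H" if "y \<in> X" for y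
      using that calculation H HS unfolding orients_def half_def by blast
    ultimately show ?thesis by (auto simp: F_def)
  qed
  then have "inj_on F (orbits (face_perm \<pi>) H)" by (rule inj_on_inverseI)
  moreover have "F ` orbits (face_perm \<pi>) H = faces \<pi>"
  proof (intro equalityI subsetI)
    fix X assume "X \<in> F ` orbits (face_perm \<pi>) H"
    then show "X \<in> faces \<pi>" using F HS by (auto simp: orbits_def traced_faces_def)
  next
    fix X assume "X \<in> faces \<pi>"
    then obtain x where x: "x \<in> states" "X = face_of arev \<sigma> \<pi> x" by (auto simp: traced_faces_def)
    show "X \<in> F ` orbits (face_perm \<pi>) H"
    proof (cases "x \<in> H")
      case True
      moreover have "F (orbit (face_perm \<pi>) x) = X" using x F by simp
      ultimately show ?thesis unfolding orbits_def by blast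
    next
      case False
      then have "mirror x \<in> H" using H x by (auto simp: orients_def half_def)
      moreover have "X = face_of arev \<sigma> \<pi> (mirror x)"
        using x mirror_mirror[of x] by (auto simp: face_of_eq[OF \<pi>])
      then have "F (orbit (face_perm \<pi>) (mirror x)) = X" using F[of "mirror x"] x by simp
      ultimately show ?thesis unfolding orbits_def by blast
    qed
  qed
  ultimately show ?thesis by (metis card_image)
qed

lemma card_orbits_face_perm:
  assumes \<pi>: "\<pi> permutes arcs G"
  shows "card (orbits (face_perm \<pi>) states) = 2 * card (faces \<pi>)"
proof -
  obtain H where H: "orients H \<pi>" using exists_orientation[OF \<pi>] ..
  have HS: "H \<subseteq> states" using H by (auto simp: orients_def half_def)
  let ?A = "orbits (face_perm \<pi>) H"
  have inH: "X \<subseteq> H" if "X \<in> ?A" for X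
    using that orients_orbit[OF H \<pi>] HS unfolding orbits_def by blast
  have split: "orbits (face_perm \<pi>) states = ?A \<union> (`) mirror ` ?A"
  proof (intro equalityI subsetI)
    fix X assume "X \<in> orbits (face_perm \<pi>) states"
    then obtain x where x: "x \<in> states" "X = orbit (face_perm \<pi>) x" by (auto simp: orbits_def)
    show "X \<in> ?A \<union> (`) mirror ` ?A"
    proof (cases "x \<in> H")
      case True
      then show ?thesis using x by (auto simp: orbits_def)
    next
      case False
      then have "mirror x \<in> H" using H x by (auto simp: orients_def half_def)
      moreover have "X = mirror ` orbit (face_perm \<pi>) (mirror x)"
        using orbit_mirror[OF \<pi>, of "mirror x"] x mirror_mirror[of x] by simp
      ultimately show ?thesis by (auto simp: orbits_def)
    qed
  next
    fix X assume "X \<in> ?A \<union> (`) mirror ` ?A"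
    then show "X \<in> orbits (face_perm \<pi>) states"
    proof
      assume "X \<in> ?A" then show ?thesis using HS by (auto simp: orbits_def)
    next
      assume "X \<in> (`) mirror ` ?A"
      then obtain x where x: "x \<in> H" "X = mirror ` orbit (face_perm \<pi>) x"
        unfolding orbits_def by blast
      then have "X = orbit (face_perm \<pi>) (mirror x)" "mirror x \<in> states"
        using orbit_mirror[OF \<pi>, of x] HS by auto
      then show ?thesis unfolding orbits_def by blast
    qed
  qed
  have disj: "?A \<inter> (`) mirror ` ?A = {}"
  proof -
    have "X \<noteq> mirror ` Y" if "X \<in> ?A" "Y \<in> ?A" for X Y
    proof
      assume eq: "X = mirror ` Y"
      obtain x where "x \<in> Y"
        using \<open>Y \<in> ?A\<close> orbit_nonempty unfolding orbits_def by (metis ex_in_conv imageE)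
      then have "x \<in> H" "mirror x \<in> H" using inH that eq by blast+
      then show False using H HS by (auto simp: orients_def half_def)
    qed
    then show ?thesis by blast
  qed
  have "inj_on ((`) mirror) ?A"
  proof (rule inj_on_inverseI)
    fix X assume "X \<in> ?A"
    then have "mirror (mirror x) = x" if "x \<in> X" for x
      using that inH HS by (intro mirror_mirror) auto
    then show "mirror ` mirror ` X = X" by (simp add: image_image)
  qed
  then have "card ((`) mirror ` ?A) = card ?A" by (rule card_image)
  moreover have "finite ?A" using finite_subset[OF HS] finite_orbits by auto
  ultimately show ?thesis
    using card_faces_orients[OF H \<pi>] disj by (simp add: split card_Un_disjoint)
qed

section \<open>Effect of a transposition on the number of faces\<close>

lemma cross_states: "a \<in> arcs G \<Longrightarrow> cross (a, 1) \<in> states" "a \<in> arcs G \<Longrightarrow> cross (a, -1) \<in> states"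
  by (simp_all add: in_states)

text \<open>Two transpositions of states change the number of orbits by at most two, and there are
  two orbits per face. If the first transposition merges two orbits, the second can at best make up
  for that loss.\<close>

lemma card_faces_transpose:
  assumes \<pi>: "\<pi> permutes arcs G" and ab: "a \<in> arcs G" "b \<in> arcs G" "a \<noteq> b"
  shows "card (faces (\<pi> \<circ> transpose a b)) \<le> Suc (card (faces \<pi>))"
    and "cross (b, 1) \<notin> orbit (face_perm \<pi>) (cross (a, 1)) \<Longrightarrow>
      card (faces (\<pi> \<circ> transpose a b)) \<le> card (faces \<pi>)"
proof -
  let ?p = "cross (a, 1)" and ?q = "cross (b, 1)" and ?p' = "cross (\<pi> a, -1)" and ?q' = "cross (\<pi> b, -1)"
  let ?g = "face_perm \<pi> \<circ> transpose ?p ?q"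
  have \<pi>ab: "\<pi> a \<in> arcs G" "\<pi> b \<in> arcs G" "\<pi> a \<noteq> \<pi> b"
    using assms by (auto simp: permutes_in_image inj_eq[OF permutes_inj])
  have "?p \<noteq> ?q" "?p' \<noteq> ?q'"
    using ab \<pi>ab by (metis cross_cross fst_conv)+
  note perm = face_perm_permutes[OF \<pi>] finite_states
  note g = permutes_comp_transpose[OF perm(1) cross_states(1)[OF ab(1)] cross_states(1)[OF ab(2)]]
  have h: "\<pi> \<circ> transpose a b permutes arcs G" using permutes_comp_transpose[OF \<pi> ab(1,2)] .
  have first: "card (orbits ?g states) = Suc (card (orbits (face_perm \<pi>) states)) \<or>
      card (orbits (face_perm \<pi>) states) = Suc (card (orbits ?g states))"
    by (rule card_orbits_transpose[OF perm]) (use ab cross_states \<open>?p \<noteq> ?q\<close> in auto)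
  have second: "card (orbits (face_perm (\<pi> \<circ> transpose a b)) states) \<le> Suc (card (orbits ?g states))"
    using card_orbits_transpose[OF g finite_states cross_states(2)[OF \<pi>ab(1)] cross_states(2)[OF \<pi>ab(2)] \<open>?p' \<noteq> ?q'\<close>]
    unfolding face_perm_transpose[OF \<pi> ab(1,2)] by linarith
  show "card (faces (\<pi> \<circ> transpose a b)) \<le> Suc (card (faces \<pi>))"
    using first second card_orbits_face_perm[OF h] card_orbits_face_perm[OF \<pi>] by linarith
  assume "?q \<notin> orbit (face_perm \<pi>) ?p"
  then have "card (orbits (face_perm \<pi>) states) = Suc (card (orbits ?g states))"
    by (rule card_orbits_merge[OF perm cross_states(1)[OF ab(1)] cross_states(1)[OF ab(2)]])
  then show "card (faces (\<pi> \<circ> transpose a b)) \<le> card (faces \<pi>)"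
    using second card_orbits_face_perm[OF h] card_orbits_face_perm[OF \<pi>] by linarith
qed

text \<open>Of the two transpositions of states, one acts inside \<open>H\<close> and the other
  inside its complement. Thus \<open>H\<close> remains invariant, and the orbits in
  \<open>H\<close>, which count the faces, are affected by a single transposition.\<close>

lemma card_faces_transpose_orients:
  assumes \<pi>: "\<pi> permutes arcs G" and H: "orients H \<pi>"
    and ab: "a \<in> arcs G" "b \<in> arcs G" "a \<noteq> b"
    and same: "cross (a, 1) \<in> H \<longleftrightarrow> cross (b, 1) \<in> H"
  shows "orients H (\<pi> \<circ> transpose a b)"
    and "card (faces (\<pi> \<circ> transpose a b)) = Suc (card (faces \<pi>)) \<or>
      card (faces \<pi>) = Suc (card (faces (\<pi> \<circ> transpose a b)))"
proof -
  let ?p = "cross (a, 1)" and ?q = "cross (b, 1)" and ?p' = "cross (\<pi> a, -1)" and ?q' = "cross (\<pi> b, -1)"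
  let ?h = "\<pi> \<circ> transpose a b"
  have HS: "H \<subseteq> states" and mir: "\<And>x. x \<in> states \<Longrightarrow> mirror x \<in> H \<longleftrightarrow> x \<notin> H"
    and clo: "\<And>x. x \<in> states \<Longrightarrow> face_perm \<pi> x \<in> H \<longleftrightarrow> x \<in> H"
    using H by (auto simp: orients_def half_def)
  \<comment> \<open>The two passages through the corner between \<open>c\<close> and
    \<open>\<pi> c\<close> belong to mutually reversed walks, so \<open>H\<close> contains the state
    leading into exactly one of them.\<close>
  have "mirror (face_perm \<pi> (cross (c, 1))) = cross (\<pi> c, -1)" if "c \<in> arcs G" for c
    using that by (simp add: face_perm_def turn_def in_states opp_def)
  then have other: "cross (\<pi> c, -1) \<in> H \<longleftrightarrow> cross (c, 1) \<notin> H" if "c \<in> arcs G" for c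
    using that mir[OF face_perm_in[OF \<pi> cross_states(1)]] clo[OF cross_states(1)] by metis
  have same': "?p' \<in> H \<longleftrightarrow> ?q' \<in> H" using other ab same by simp
  have h: "?h permutes arcs G" using permutes_comp_transpose[OF \<pi> ab(1,2)] .
  have \<pi>ab: "\<pi> a \<in> arcs G" "\<pi> b \<in> arcs G" "\<pi> a \<noteq> \<pi> b"
    using assms by (auto simp: permutes_in_image inj_eq[OF permutes_inj])
  have neq: "?p \<noteq> ?q" "?p' \<noteq> ?q'"
    using ab \<pi>ab by (metis cross_cross fst_conv)+
  have st: "?p \<in> states" "?q \<in> states" "?p' \<in> states" "?q' \<in> states"
    using cross_states ab \<pi>ab by auto
  have eq: "face_perm ?h x = face_perm \<pi> (transpose ?p ?q (transpose ?p' ?q' x))" for x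
    by (simp add: face_perm_transpose[OF \<pi> ab(1,2)])
  show Hh: "orients H ?h"
  proof -
    have "transpose r s x \<in> X \<longleftrightarrow> x \<in> X" if "r \<in> X \<longleftrightarrow> s \<in> X" for r s x and X :: "('b \<times> int) set"
      using that by (simp add: transpose_def)
    then have "transpose ?p ?q (transpose ?p' ?q' x) \<in> X \<longleftrightarrow> x \<in> X"
      if "X = H \<or> X = states" for x X using that same same' st by metis
    then have "face_perm ?h x \<in> H \<longleftrightarrow> x \<in> H" if "x \<in> states" for x
      using that clo unfolding eq by blast
    then show ?thesis using H by (simp add: orients_def)
  qed
  let ?R = "perm_restrict (face_perm \<pi>) H"
  have R: "?R permutes H" "finite H"
    using perm_restrict_permutes[OF face_perm_permutes[OF \<pi>] finite_states HS] clo HS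
      finite_subset[OF HS] by auto
  have card: "card (faces \<rho>) = card (orbits (perm_restrict (face_perm \<rho>) H) H)"
    if "orients H \<rho>" "\<rho> permutes arcs G" for \<rho>
  proof -
    have "orbits (perm_restrict (face_perm \<rho>) H) H = orbits (face_perm \<rho>) H"
      using that HS by (intro orbits_perm_restrict) (auto simp: orients_def)
    then show ?thesis using card_faces_orients[OF that] by simp
  qed
  have "\<exists>r\<in>H. \<exists>s\<in>H. r \<noteq> s \<and> perm_restrict (face_perm ?h) H = ?R \<circ> transpose r s"
  proof (cases "?p \<in> H")
    case True
    then have "?q \<in> H" "?p' \<notin> H" "?q' \<notin> H" using same other ab by auto
    with True have "perm_restrict (face_perm ?h) H = ?R \<circ> transpose ?p ?q"
      by (auto simp: fun_eq_iff perm_restrict_def eq transpose_def)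
    then show ?thesis using True \<open>?q \<in> H\<close> neq by blast
  next
    case False
    then have "?q \<notin> H" "?p' \<in> H" "?q' \<in> H" using same other ab by auto
    with False have "perm_restrict (face_perm ?h) H = ?R \<circ> transpose ?p' ?q'"
      by (auto simp: fun_eq_iff perm_restrict_def eq transpose_def)
    then show ?thesis using \<open>?p' \<in> H\<close> \<open>?q' \<in> H\<close> neq by blast
  qed
  then show "card (faces ?h) = Suc (card (faces \<pi>)) \<or> card (faces \<pi>) = Suc (card (faces ?h))"
    using card_orbits_transpose[OF R] card[OF H \<pi>] card[OF Hh h] by metis
qed

text \<open>
  If the face orientation \<open>H\<close> is respected by every cycle of \<open>inv \<psi> \<circ> \<pi>\<close>, one can pass from
  \<open>\<pi>\<close> to \<open>\<psi>\<close> by transpositions that respect it.  Each of them changes the number of faces and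
  the number of cycles of the permutation by one.
\<close>

lemma even_faces_plus_cycles:
  assumes \<psi>: "\<psi> permutes arcs G"
    and "\<pi> permutes arcs G" "orients H \<pi>"
    and "\<And>a. a \<in> arcs G \<Longrightarrow> cross (inv \<psi> (\<pi> a), 1) \<in> H \<longleftrightarrow> cross (a, 1) \<in> H"
  shows "even (card (faces \<pi>) + card (orbits \<pi> (arcs G))
    + (card (faces \<psi>) + card (orbits \<psi> (arcs G))))"
  using assms(2-)
\<comment> \<open>The measure is the least number of transpositions whose product is
  \<open>inv \<psi> \<circ> \<pi>\<close>; it vanishes exactly when
  \<open>\<pi> = \<psi>\<close>.\<close>
proof (induction "card (arcs G) - card (orbits (inv \<psi> \<circ> \<pi>) (arcs G))" arbitrary: \<pi> rule: less_induct)
  case less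
  note \<pi> = less.prems(1)
  let ?\<theta> = "inv \<psi> \<circ> \<pi>"
  have \<theta>: "?\<theta> permutes arcs G" using permutes_compose[OF \<pi> permutes_inv[OF \<psi>]] .
  show ?case
  proof (cases "\<forall>a\<in>arcs G. ?\<theta> a = a")
    case True
    then have "\<pi> = \<psi>" using permutes_eqI[OF \<pi> \<psi>] by simp
    then show ?thesis by simp
  next
    case False
    then obtain a where a: "a \<in> arcs G" "?\<theta> a \<noteq> a" by blast
    define b where "b = ?\<theta> a"
    have b: "b \<in> arcs G" "a \<noteq> b" "b \<in> orbit ?\<theta> a"
      using a \<theta> permutes_in_image[OF \<theta>] orbit.base[of ?\<theta> a] by (auto simp: b_def)
    let ?\<rho> = "\<pi> \<circ> transpose a b"
    have \<rho>: "?\<rho> permutes arcs G" using permutes_comp_transpose[OF \<pi> a(1) b(1)] .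
    have same: "cross (a, 1) \<in> H \<longleftrightarrow> cross (b, 1) \<in> H" using less.prems(3)[OF a(1)] by (simp add: b_def)
    note step = card_faces_transpose_orients[OF \<pi> less.prems(2) a(1) b(1,2) same]
    have comp: "inv \<psi> \<circ> ?\<rho> = ?\<theta> \<circ> transpose a b" by (simp add: comp_assoc)
    \<comment> \<open>Since \<open>b = ?\<theta> a\<close>, the transposition splits
      \<open>b\<close> off its cycle as a fixed point.\<close>
    have "card (orbits (inv \<psi> \<circ> ?\<rho>) (arcs G)) = Suc (card (orbits ?\<theta> (arcs G)))"
      unfolding comp by (rule card_orbits_split[OF \<theta> finite_arcs a(1) b])
    then have "card (arcs G) - card (orbits (inv \<psi> \<circ> ?\<rho>) (arcs G))
        < card (arcs G) - card (orbits ?\<theta> (arcs G))"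
      using card_orbits_le[OF finite_arcs, of "inv \<psi> \<circ> ?\<rho>"] by linarith
    moreover have "cross (inv \<psi> (?\<rho> c), 1) \<in> H \<longleftrightarrow> cross (c, 1) \<in> H" if "c \<in> arcs G" for c
      using less.prems(3)[OF that] less.prems(3)[OF a(1)] less.prems(3)[OF b(1)] same
      by (auto simp: transpose_def)
    ultimately have "even (card (faces ?\<rho>) + card (orbits ?\<rho> (arcs G))
        + (card (faces \<psi>) + card (orbits \<psi> (arcs G))))"
      using less.hyps \<rho> step(1) by blast
    moreover have "card (orbits ?\<rho> (arcs G)) = Suc (card (orbits \<pi> (arcs G))) \<or>
        card (orbits \<pi> (arcs G)) = Suc (card (orbits ?\<rho> (arcs G)))"
      by (rule card_orbits_transpose[OF \<pi> finite_arcs a(1) b(1,2)])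
    ultimately show ?thesis using step(2) by auto
  qed
qed

subsection \<open>Moving from one rotation system towards another\<close>

lemma rotation_system_orbit:
  "rotation_system G \<pi> \<longleftrightarrow>
    \<pi> permutes arcs G \<and> (\<forall>a\<in>arcs G. orbit \<pi> a = out_arcs G (tail G a))"
proof -
  have "orbit \<pi> a = out_arcs G (tail G a)"
    if "\<forall>v\<in>verts G. out_arcs G v \<noteq> {} \<longrightarrow> cyclic_on \<pi> (out_arcs G v)" "a \<in> arcs G" for a
  proof -
    have "a \<in> out_arcs G (tail G a)" using that by simp
    then show ?thesis using that tail_in_verts orbit_cyclic_eq3 by (metis empty_iff)
  qed
  moreover have "cyclic_on \<pi> (out_arcs G v)"
    if "\<forall>a\<in>arcs G. orbit \<pi> a = out_arcs G (tail G a)" "out_arcs G v \<noteq> {}" for v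
    unfolding cyclic_on_alldef using that by (auto simp del: in_in_arcs_conv)
  ultimately show ?thesis unfolding rotation_system_def by blast
qed

text \<open>The right-hand side does not mention \<open>\<pi>\<close>, so all rotation systems have
  the same cycles as sets of darts, and hence equally many.\<close>

lemma rotation_system_orbits:
  assumes "rotation_system G \<pi>"
  shows "orbits \<pi> (arcs G) = (\<lambda>a. out_arcs G (tail G a)) ` arcs G"
  using assms by (simp add: orbits_def rotation_system_orbit)

lemma rotation_system_tail:
  assumes "rotation_system G \<pi>" "a \<in> arcs G"
  shows "tail G (\<pi> a) = tail G a"
proof -
  have "\<pi> a \<in> out_arcs G (tail G a)" using assms orbit.base[of \<pi> a] by (simp add: rotation_system_orbit)
  then show ?thesis by simp
qed

text \<open>If tails are preserved, every cycle lies at one vertex. Having as many cycles as some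
  rotation system then leaves just one cycle for each vertex that has darts.\<close>

lemma rotation_systemI:
  assumes \<zeta>: "rotation_system G \<zeta>" and \<pi>: "\<pi> permutes arcs G"
    and tail: "\<And>a. a \<in> arcs G \<Longrightarrow> tail G (\<pi> a) = tail G a"
    and card: "card (orbits \<pi> (arcs G)) = card (orbits \<zeta> (arcs G))"
  shows "rotation_system G \<pi>"
proof -
  note perm = \<pi> finite_arcs
  \<comment> \<open>\<open>h\<close> sends a cycle to the set of all darts at its vertex. It is onto
    a finite set of the same cardinality, hence injective.\<close>
  define h where "h X = (\<Union>x\<in>X. out_arcs G (tail G x))" for X
  have sub: "orbit \<pi> a \<subseteq> out_arcs G (tail G a)" if "a \<in> arcs G" for a
    using that tail permutes_in_image[OF \<pi>] by (intro orbit_subset_closed) auto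
  have h: "h (orbit \<pi> a) = out_arcs G (tail G a)" if "a \<in> arcs G" for a
    using sub[OF that] self_in_orbit_permutes[OF perm, of a] unfolding h_def by fastforce
  have "h ` orbits \<pi> (arcs G) = (\<lambda>a. out_arcs G (tail G a)) ` arcs G"
    using h by (simp add: orbits_def image_image)
  then have "card (h ` orbits \<pi> (arcs G)) = card (orbits \<pi> (arcs G))"
    using card rotation_system_orbits[OF \<zeta>] by simp
  then have inj: "inj_on h (orbits \<pi> (arcs G))"
    using finite_orbits[OF finite_arcs] by (rule eq_card_imp_inj_on[rotated])
  have "out_arcs G (tail G a) \<subseteq> orbit \<pi> a" if a: "a \<in> arcs G" for a
  proof
    fix b assume "b \<in> out_arcs G (tail G a)"
    then have b: "b \<in> arcs G" "tail G b = tail G a" by auto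
    then have "orbit \<pi> b = orbit \<pi> a"
      using inj_onD[OF inj, of "orbit \<pi> b" "orbit \<pi> a"] h a by (simp add: orbits_def)
    then show "b \<in> orbit \<pi> a" using self_in_orbit_permutes[OF perm, of b] by simp
  qed
  then show ?thesis using sub \<pi> by (auto simp: rotation_system_orbit)
qed

text \<open>
  Undoing one transposition of \<open>inv \<psi> \<circ> \<pi>\<close> splits a vertex of \<open>\<pi>\<close>.  Since the vertices of
  \<open>\<psi>\<close> are not split, some further cycle of \<open>inv \<psi> \<circ> \<pi>\<close> connects the two parts.
\<close>

lemma rotation_system_step:
  assumes \<pi>: "rotation_system G \<pi>" and \<psi>: "rotation_system G \<psi>"
    and a: "a \<in> arcs G" and ab: "b = inv \<psi> (\<pi> a)" "b \<noteq> a"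
  obtains c d where "c \<in> arcs G" "d \<in> arcs G" "c \<noteq> d"
    "rotation_system G (\<pi> \<circ> transpose a b \<circ> transpose c d)"
    "card (orbits (inv \<psi> \<circ> \<pi>) (arcs G))
      < card (orbits (inv \<psi> \<circ> (\<pi> \<circ> transpose a b \<circ> transpose c d)) (arcs G))"
proof -
  have p\<pi>: "\<pi> permutes arcs G" and p\<psi>: "\<psi> permutes arcs G"
    using \<pi> \<psi> by (auto simp: rotation_system_def)
  let ?\<theta> = "inv \<psi> \<circ> \<pi>"
  have \<theta>: "?\<theta> permutes arcs G" using permutes_compose[OF p\<pi> permutes_inv[OF p\<psi>]] .
  have b: "b \<in> arcs G" "b \<in> orbit ?\<theta> a"
    using a permutes_in_image[OF \<theta>] orbit.base[of ?\<theta> a] by (auto simp: ab(1))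
  have tail\<theta>: "tail G (?\<theta> x) = tail G x" if "x \<in> arcs G" for x
    using rotation_system_tail[OF \<psi>, of "?\<theta> x"] rotation_system_tail[OF \<pi> that] that
      permutes_in_image[OF \<theta>] permutes_inverses(1)[OF p\<psi>] by simp
  have tab: "tail G b = tail G a" using tail\<theta>[OF a] ab by simp
  let ?\<pi>1 = "\<pi> \<circ> transpose a b" and ?\<theta>1 = "?\<theta> \<circ> transpose a b"
  have \<pi>1: "?\<pi>1 permutes arcs G" using permutes_comp_transpose[OF p\<pi> a b(1)] .
  have \<theta>1: "?\<theta>1 permutes arcs G" using permutes_comp_transpose[OF \<theta> a b(1)] .
  have "b \<in> orbit \<pi> a" using \<pi> a b tab by (simp add: rotation_system_orbit)
  note split = orbit_transpose_split[OF p\<pi> finite_arcs ab(2)[symmetric] this]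
    card_orbits_split[OF p\<pi> finite_arcs a b(1) ab(2)[symmetric] this]
  have "\<exists>c\<in>arcs G. ?\<theta>1 c \<notin> orbit ?\<pi>1 c"
  proof (rule ccontr)
    assume "\<not> ?thesis"
    then have all: "?\<theta>1 c \<in> orbit ?\<pi>1 c" if "c \<in> arcs G" for c using that by blast
    \<comment> \<open>\<open>\<psi>\<close> undoes \<open>?\<theta>1\<close> and then applies
      \<open>?\<pi>1\<close>. If \<open>?\<theta>1\<close> kept every dart in its cycle of
      \<open>?\<pi>1\<close>, so would \<open>\<psi>\<close>, although \<open>\<psi>\<close> has
      \<open>a\<close> and \<open>b\<close> in one cycle and \<open>?\<pi>1\<close> does
      not.\<close>
    have closed: "\<psi> e \<in> orbit ?\<pi>1 e \<and> \<psi> e \<in> arcs G" if e: "e \<in> arcs G" for e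
    proof -
      obtain c where c: "c \<in> arcs G" "e = ?\<theta>1 c"
        using e permutes_image[OF \<theta>1] by (metis imageE)
      have "\<psi> e = ?\<pi>1 c" using c(2) permutes_inverses(1)[OF p\<psi>] by simp
      also have "?\<pi>1 c \<in> orbit ?\<pi>1 c" by (rule orbit.base)
      also have "orbit ?\<pi>1 c = orbit ?\<pi>1 e"
        using orbit_eq_permutes[OF \<pi>1 finite_arcs all[OF c(1)]] c(2) by simp
      finally show ?thesis using e permutes_in_image[OF p\<psi>] by simp
    qed
    have "orbit \<psi> a \<subseteq> orbit ?\<pi>1 a \<inter> arcs G"
      using closed orbit_eq_permutes[OF \<pi>1 finite_arcs] self_in_orbit_permutes[OF \<pi>1 finite_arcs] a
      by (intro orbit_subset_closed) auto
    moreover have "b \<in> orbit \<psi> a" using \<psi> a b tab by (simp add: rotation_system_orbit)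
    ultimately show False using split(1) by blast
  qed
  then obtain c where c: "c \<in> arcs G" "?\<theta>1 c \<notin> orbit ?\<pi>1 c" by blast
  define d where "d = ?\<theta>1 c"
  have d: "d \<in> arcs G" "c \<noteq> d" "d \<notin> orbit ?\<pi>1 c" "d \<in> orbit ?\<theta>1 c"
    using c permutes_in_image[OF \<theta>1] self_in_orbit_permutes[OF \<pi>1 finite_arcs, of c] orbit.base[of ?\<theta>1 c]
    unfolding d_def by auto
  have t: "transpose a b x \<in> arcs G" "tail G (transpose a b x) = tail G x" if "x \<in> arcs G" for x
    using that a b tab by (auto simp: transpose_def)
  have tcd: "tail G d = tail G c" using tail\<theta> t c by (simp add: d_def)
  let ?\<pi>2 = "?\<pi>1 \<circ> transpose c d"
  have "tail G (?\<pi>2 x) = tail G x" if x: "x \<in> arcs G" for x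
  proof -
    have "transpose c d x \<in> arcs G" "tail G (transpose c d x) = tail G x"
      using x c d tcd by (auto simp: transpose_def)
    then show ?thesis using rotation_system_tail[OF \<pi>] t by simp
  qed
  \<comment> \<open>The second transposition merges two cycles and so makes up for the split caused
    by the first.\<close>
  moreover have "card (orbits ?\<pi>2 (arcs G)) = card (orbits \<pi> (arcs G))"
    using card_orbits_merge[OF \<pi>1 finite_arcs c(1) d(1,3)] split(2) by simp
  ultimately have "rotation_system G ?\<pi>2"
    using rotation_systemI[OF \<pi> permutes_comp_transpose[OF \<pi>1 c(1) d(1)]] by blast
  \<comment> \<open>For \<open>?\<theta>\<close> both transpositions are splits, because
    \<open>b\<close> and \<open>d\<close> are the images of \<open>a\<close> and \<open>c\<close>
    under the permutation being split.\<close>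
  moreover have "card (orbits ?\<theta> (arcs G)) < card (orbits (inv \<psi> \<circ> ?\<pi>2) (arcs G))"
    using card_orbits_split[OF \<theta>1 finite_arcs c(1) d(1,2,4)]
      card_orbits_split[OF \<theta> finite_arcs a b(1) ab(2)[symmetric] b(2)]
    by (simp add: comp_assoc)
  ultimately show ?thesis using that c(1) d(1,2) by blast
qed

section \<open>Interpolation of face counts and of Euler genera\<close>

lemma face_count_interpolation:
  assumes \<psi>: "rotation_system G \<psi>" "k \<le> card (faces \<psi>)" "even (k + card (faces \<psi>))"
    and "rotation_system G \<pi>" "card (faces \<pi>) \<le> k"
  shows "\<exists>\<rho>. rotation_system G \<rho> \<and> card (faces \<rho>) = k"
  using assms(4,5)
proof (induction "card (arcs G) - card (orbits (inv \<psi> \<circ> \<pi>) (arcs G))" arbitrary: \<pi> rule: less_induct)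
  case less
  note \<pi> = less.prems(1)
  have p\<pi>: "\<pi> permutes arcs G" and p\<psi>: "\<psi> permutes arcs G"
    using \<pi> \<psi> by (auto simp: rotation_system_def)
  let ?\<theta> = "inv \<psi> \<circ> \<pi>"
  have \<theta>: "?\<theta> permutes arcs G" using permutes_compose[OF p\<pi> permutes_inv[OF p\<psi>]] .
  show ?case
  proof (cases "card (faces \<pi>) = k")
    case True
    then show ?thesis using \<pi> by blast
  next
    case False
    then have lt: "card (faces \<pi>) < k" using less.prems by simp
    \<comment> \<open>It is enough to stay strictly below \<open>k\<close> after the first
      transposition, since the second adds at most one face.\<close>
    have "\<exists>a\<in>arcs G. ?\<theta> a \<noteq> a \<and> card (faces (\<pi> \<circ> transpose a (?\<theta> a))) < k"
    proof (cases "Suc (card (faces \<pi>)) < k")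
      case True
      have "\<exists>a\<in>arcs G. ?\<theta> a \<noteq> a"
      proof (rule ccontr)
        assume "\<not> ?thesis"
        then have "\<pi> = \<psi>" using permutes_eqI[OF p\<pi> p\<psi>] by simp
        then show False using lt \<psi>(2) by simp
      qed
      then obtain a where a: "a \<in> arcs G" "?\<theta> a \<noteq> a" by blast
      then show ?thesis
        using card_faces_transpose(1)[OF p\<pi> a(1), of "?\<theta> a"] permutes_in_image[OF \<theta>] True
        by (intro bexI[of _ a]) auto
    next
      case False
      then have "k = Suc (card (faces \<pi>))" using lt by simp
      then have odd: "odd (card (faces \<pi>) + card (faces \<psi>))" using \<psi>(3) by simp
      obtain H where H: "orients H \<pi>" using exists_orientation[OF p\<pi>] ..
      \<comment> \<open>Otherwise every dart and its image under \<open>?\<theta>\<close> would give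
        states on one directed facial walk, hence on the same side of \<open>H\<close>, and the
        parity lemma would apply.\<close>
      have "\<exists>a\<in>arcs G. cross (?\<theta> a, 1) \<notin> orbit (face_perm \<pi>) (cross (a, 1))"
      proof (rule ccontr)
        assume "\<not> ?thesis"
        then have "cross (inv \<psi> (\<pi> a), 1) \<in> H \<longleftrightarrow> cross (a, 1) \<in> H" if "a \<in> arcs G" for a
          using orients_orbit[OF H p\<pi> cross_states(1)[OF that]] that by auto
        from even_faces_plus_cycles[OF p\<psi> p\<pi> H this]
        have "even (card (faces \<pi>) + card (orbits \<pi> (arcs G))
          + (card (faces \<psi>) + card (orbits \<psi> (arcs G))))" .
        \<comment> \<open>The cycle counts cancel modulo 2, so the parity statement concerns the
          faces alone.\<close>
        moreover have "orbits \<pi> (arcs G) = orbits \<psi> (arcs G)"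
          using rotation_system_orbits[OF \<pi>] rotation_system_orbits[OF \<psi>(1)] by simp
        ultimately show False using odd by auto
      qed
      then obtain a where a: "a \<in> arcs G"
        and o: "cross (?\<theta> a, 1) \<notin> orbit (face_perm \<pi>) (cross (a, 1))" by blast
      have "?\<theta> a \<noteq> a"
        using o self_in_orbit_permutes[OF face_perm_permutes[OF p\<pi>] finite_states] by metis
      moreover have "?\<theta> a \<in> arcs G" using a permutes_in_image[OF \<theta>] by simp
      ultimately have "card (faces (\<pi> \<circ> transpose a (?\<theta> a))) \<le> card (faces \<pi>)"
        using o by (intro card_faces_transpose(2)[OF p\<pi> a]) auto
      then show ?thesis using a \<open>?\<theta> a \<noteq> a\<close> lt by (intro bexI[of _ a]) auto
    qed
    then obtain a where a: "a \<in> arcs G" "?\<theta> a \<noteq> a"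
      and fa: "card (faces (\<pi> \<circ> transpose a (?\<theta> a))) < k" by blast
    define b where "b = inv \<psi> (\<pi> a)"
    have b: "b \<noteq> a" "b \<in> arcs G" using a permutes_in_image[OF \<theta>] by (auto simp: b_def)
    obtain c d where cd: "c \<in> arcs G" "d \<in> arcs G" "c \<noteq> d"
      and rot: "rotation_system G (\<pi> \<circ> transpose a b \<circ> transpose c d)"
      and dist: "card (orbits ?\<theta> (arcs G))
        < card (orbits (inv \<psi> \<circ> (\<pi> \<circ> transpose a b \<circ> transpose c d)) (arcs G))"
      by (rule rotation_system_step[OF \<pi> \<psi>(1) a(1) b_def b(1)])
    have "card (faces (\<pi> \<circ> transpose a b \<circ> transpose c d)) \<le> k"
      using card_faces_transpose(1)[OF permutes_comp_transpose[OF p\<pi> a(1) b(2)] cd] fa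
      by (simp add: b_def)
    moreover have "card (arcs G) - card (orbits (inv \<psi> \<circ> (\<pi> \<circ> transpose a b \<circ> transpose c d)) (arcs G))
        < card (arcs G) - card (orbits ?\<theta> (arcs G))"
      using dist card_orbits_le[OF finite_arcs, of "inv \<psi> \<circ> (\<pi> \<circ> transpose a b \<circ> transpose c d)"]
      by linarith
    ultimately show ?thesis using less.hyps rot by blast
  qed
qed

lemma euler_genus_interpolation:
  assumes "g\<^sub>1 \<in> euler_genus_spectrum G arev \<sigma>" "g\<^sub>2 \<in> euler_genus_spectrum G arev \<sigma>"
    and "g\<^sub>1 \<le> g" "g \<le> g\<^sub>2" "[g = g\<^sub>1] (mod 2)"
  shows "g \<in> euler_genus_spectrum G arev \<sigma>"
proof -
  define C where "C = int (card (edge_set G arev)) - int (card (verts G)) + 2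
    - int (card {v \<in> verts G. out_arcs G v = {}})"
  have eg: "euler_genus G arev \<sigma> \<pi> = C - int (card (faces \<pi>))" for \<pi>
    by (simp add: euler_genus_def num_faces_def C_def)
  \<comment> \<open>The smaller genus has the larger number of faces, so \<open>g\<^sub>1\<close>
    supplies the target \<open>\<psi>\<close> and \<open>g\<^sub>2\<close> the starting point
    \<open>\<pi>\<close>.\<close>
  obtain \<psi> \<pi> where \<psi>: "rotation_system G \<psi>" "g\<^sub>1 = C - int (card (faces \<psi>))"
    and \<pi>: "rotation_system G \<pi>" "g\<^sub>2 = C - int (card (faces \<pi>))"
    using assms(1,2) by (auto simp: euler_genus_spectrum_def eg)
  define k where "k = nat (C - g)"
  \<comment> \<open>No truncation occurs in \<open>nat\<close>: \<open>C - g\<close> is at least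
    \<open>C - g\<^sub>2\<close>, which is a number of faces.\<close>
  have k: "int k = C - g" using assms(4) \<pi>(2) by (simp add: k_def)
  have "int (k + card (faces \<psi>)) = 2 * int (card (faces \<psi>)) - (g - g\<^sub>1)"
    using k \<psi>(2) by simp
  moreover have "even (g - g\<^sub>1)" using assms(5) by (simp add: cong_iff_dvd_diff)
  ultimately have "even (int (k + card (faces \<psi>)))" by simp
  then have "even (k + card (faces \<psi>))" by (simp only: even_of_nat)
  moreover have "k \<le> card (faces \<psi>)" "card (faces \<pi>) \<le> k"
    using k assms(3,4) \<psi>(2) \<pi>(2) by linarith+
  ultimately obtain \<rho> where "rotation_system G \<rho>" "card (faces \<rho>) = k"
    using face_count_interpolation \<psi>(1) \<pi>(1) by blast
  then have "rotation_system G \<rho>" "euler_genus G arev \<sigma> \<rho> = g" using eg k by simp_all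
  then show ?thesis by (auto simp: euler_genus_spectrum_def)
qed

end

theorem theorem1p4:
  fixes G :: "('a, 'b) pre_digraph" and arev :: "'b \<Rightarrow> 'b" and \<sigma> :: "'b set \<Rightarrow> int"
    and i :: int
  assumes "signed_graph G arev \<sigma>"
    and "connected G"
    and "i \<in> {0, 1}"
    and "parity_spectrum G arev \<sigma> i \<noteq> {}"
  shows "parity_spectrum G arev \<sigma> i =
    {x. Min (parity_spectrum G arev \<sigma> i) \<le> x \<and> x \<le> Max (parity_spectrum G arev \<sigma> i)
        \<and> [x = i] (mod 2)}"
proof -
  interpret signed_graph G arev \<sigma> by fact
  let ?S = "parity_spectrum G arev \<sigma> i"
  have fin: "finite ?S" by (rule finite_parity_spectrum)
  note ends = Min_in[OF fin assms(4)] Max_in[OF fin assms(4)]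
  show ?thesis
  proof (intro equalityI subsetI)
    fix x assume "x \<in> ?S"
    then show "x \<in> {x. Min ?S \<le> x \<and> x \<le> Max ?S \<and> [x = i] (mod 2)}"
      using fin by (auto simp: parity_spectrum_def)
  next
    fix x assume x: "x \<in> {x. Min ?S \<le> x \<and> x \<le> Max ?S \<and> [x = i] (mod 2)}"
    moreover have "[Min ?S = i] (mod 2)" using ends(1) by (simp add: parity_spectrum_def)
    ultimately have "[x = Min ?S] (mod 2)" by (metis cong_sym cong_trans mem_Collect_eq)
    then have "x \<in> euler_genus_spectrum G arev \<sigma>"
      using euler_genus_interpolation[of "Min ?S" "Max ?S" x] ends x by (simp add: parity_spectrum_def)
    then show "x \<in> ?S" using x by (simp add: parity_spectrum_def)
  qed
qed

end
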